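(* Let $S$ be a semilattice equipped with the order-algebraic convexity. Then $S$ is a convex geometry if and only if $S$ is a tree. In this case, when $S$ is endowed with a Hausdorff topology making it a semitopological semilattice, it satisfies the Krein--Milman property: every compact convex subset $K$ of $S$ equals the topological closure of $\operatorname{co}(\operatorname{ex}K)$.
   Context: A semilattice is a poset $S$ in which every nonempty finite subset has a supremum; write $x\oplus y$ for the supremum of $\{x,y\}$. The order-algebraic convexity on $S$ has as convex sets the order-convex subsemilattices: the subsets $T$ closed under $\oplus$ (possibly empty) such that $x\leqslant y\leqslant z$ and $x,z\in T$ imply $y\in T$. $\operatorname{co}(A)$ is the intersection of all convex sets containing $A$. A point $x\in K$ is an extreme point of $K$ if $x\notin\operatorname{co}(K\setminus\{x\})$; $\operatorname{ex}K$ is the set of extreme points of $K$. A convexity is a convex geometry if, for every convex subset $K$ and all $x\neq y$, neither in $K$, $y\in\operatorname{co}(K\cup\{x\})$ implies $x\notin\operatorname{co}(K\cup\{y\})$. A tree is a semilattice in which every principal filter $\uparrow x=\{y: y\geqslant x\}$ is a chain. A semilattice with a topology is semitopological if $\oplus$ is separately continuous, i.e. $y\mapsto x\oplus y$ is continuous for each $x$. *)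

theory Defs
  imports "HOL-Analysis.Analysis"
begin

text \<open>
  A convexity is given by the predicate \<open>C\<close> selecting its convex sets; the hull \<open>co(A)\<close> is
  then the library's \<open>C hull A\<close>, the intersection of all sets satisfying \<open>C\<close> that contain \<open>A\<close>.
\<close>

definition order_algebraic_convex :: "'a::semilattice_sup set \<Rightarrow> bool" where
  "order_algebraic_convex K \<longleftrightarrow>
     (\<forall>x\<in>K. \<forall>y\<in>K. sup x y \<in> K) \<and>
     (\<forall>x y z. x \<le> y \<and> y \<le> z \<and> x \<in> K \<and> z \<in> K \<longrightarrow> y \<in> K)"

definition extreme_points :: "('a set \<Rightarrow> bool) \<Rightarrow> 'a set \<Rightarrow> 'a set" where
  "extreme_points C K = {x \<in> K. x \<notin> C hull (K - {x})}"

definition convex_geometry :: "('a set \<Rightarrow> bool) \<Rightarrow> bool" where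
  "convex_geometry C \<longleftrightarrow>
     (\<forall>K x y. C K \<and> x \<noteq> y \<and> x \<notin> K \<and> y \<notin> K \<and> y \<in> C hull (K \<union> {x})
        \<longrightarrow> x \<notin> C hull (K \<union> {y}))"

definition is_tree :: "'a::semilattice_sup itself \<Rightarrow> bool" where
  "is_tree _ \<longleftrightarrow> (\<forall>x::'a. Complete_Partial_Order.chain (\<le>) {x..})"

definition semitopological_semilattice :: "'a::semilattice_sup topology \<Rightarrow> bool" where
  "semitopological_semilattice T \<longleftrightarrow>
     topspace T = UNIV \<and> (\<forall>x. continuous_map T T (\<lambda>y. sup x y))"

definition krein_milman_property :: "('a set \<Rightarrow> bool) \<Rightarrow> 'a topology \<Rightarrow> bool" where
  "krein_milman_property C T \<longleftrightarrow>
     (\<forall>K. C K \<and> compactin T K \<longrightarrow> K = T closure_of (C hull extreme_points C K))"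

end

theory Submission
  imports Defs
begin

text \<open>
  The equivalence rests on how a hull grows when one point \<open>x\<close> is added to a convex set \<open>K\<close>:
  every element of \<open>co(K \<union> {x})\<close> lies above an element of \<open>K \<union> {x}\<close> and below \<open>x\<close> or
  some \<open>x \<oplus> k\<close> with \<open>k \<in> K\<close>. In a tree, once \<open>x\<close> lies above some \<open>a \<in> K\<close>, the join
  \<open>x \<oplus> k = x \<oplus> (a \<oplus> k)\<close> is a join in the chain \<open>\<up>a\<close>, so it is \<open>x\<close> or an element
  of \<open>K\<close>; hence the new elements of the hull all lie below \<open>x\<close> (lemma
  \<open>tree_hull_insert_le\<close>). If \<open>x\<close> and \<open>y\<close> generate each other over \<open>K\<close>, then
  each is below the other; when neither lies above an element of \<open>K\<close>, this is what the lower
  bounds say. Antisymmetry gives \<open>x = y\<close>. Conversely, if \<open>y\<close> and \<open>z\<close> are incomparable above \<open>x\<close>, then over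
  the interval \<open>[x, z]\<close> the points \<open>y\<close> and \<open>y \<oplus> z\<close> generate each other.

  The Krein--Milman property holds in the stronger form \<open>K = co(ex K)\<close>. Separate continuity and
  the Hausdorff axiom make all principal filters and principal ideals closed, so
  compactness gives a nonempty \<open>K\<close> a greatest element \<open>t\<close>, and a minimal element
  below each of its points. Minimal elements are always extreme, so by order-convexity it is enough
  to see that \<open>t\<close> belongs to \<open>co(ex K)\<close>. If \<open>t\<close> is not itself extreme, then \<open>t = a \<oplus> b\<close> with
  \<open>a, b < t\<close>; in a tree \<open>t\<close> is then already the join of any two minimal elements below
  \<open>a\<close> and \<open>b\<close> (lemma \<open>tree_sup_of_lower\<close>).
\<close>

section \<open>Order-algebraic hulls\<close>

lemma order_algebraic_convex_sup:
  "order_algebraic_convex K \<Longrightarrow> x \<in> K \<Longrightarrow> y \<in> K \<Longrightarrow> sup x y \<in> K"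
  using order_algebraic_convex_def[of K] by (iprover dest: bspec)

lemma order_algebraic_convex_between:
  "order_algebraic_convex K \<Longrightarrow> x \<in> K \<Longrightarrow> z \<in> K \<Longrightarrow> x \<le> y \<Longrightarrow> y \<le> z \<Longrightarrow> y \<in> K"
  using order_algebraic_convex_def[of K] by iprover

lemma order_algebraic_convex_Inter:
  assumes "\<And>K. K \<in> \<K> \<Longrightarrow> order_algebraic_convex K"
  shows "order_algebraic_convex (\<Inter>\<K>)"
  unfolding order_algebraic_convex_def[of "\<Inter>\<K>"]
proof (intro conjI ballI allI impI InterI)
  show "sup x y \<in> K" if "x \<in> \<Inter>\<K>" "y \<in> \<Inter>\<K>" "K \<in> \<K>" for x y K
    using order_algebraic_convex_sup[OF assms] that by blast
  show "y \<in> K" if "x \<le> y \<and> y \<le> z \<and> x \<in> \<Inter>\<K> \<and> z \<in> \<Inter>\<K>" "K \<in> \<K>" for x y z K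
    using order_algebraic_convex_between[OF assms, of K x z y] that by blast
qed

lemma order_algebraic_convex_hull:
  "order_algebraic_convex (order_algebraic_convex hull A)"
  unfolding hull_def by (rule order_algebraic_convex_Inter) simp

lemma order_algebraic_convex_interval:
  "order_algebraic_convex {x..z::'a::semilattice_sup}"
  unfolding order_algebraic_convex_def 
  by (intro conjI ballI allI impI) (simp add: le_supI1, meson atLeastAtMost_iff order_trans)

text \<open>
  Lower bounds need no joins, since every finite join lies above each of its terms; upper
  bounds need only one join with \<open>x\<close>, since \<open>K\<close> is closed under joins. The bound
  \<open>b \<le> x\<close> is listed separately for the sake of empty \<open>K\<close>.
\<close>
lemma hull_insert_bounds:
  fixes K :: "'a::semilattice_sup set"
  assumes K: "order_algebraic_convex K" and b: "b \<in> order_algebraic_convex hull (K \<union> {x})"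
  shows "\<exists>a\<in>K \<union> {x}. a \<le> b" and "b \<le> x \<or> (\<exists>k\<in>K. b \<le> sup x k)"
proof -
  define H where "H = {b. (\<exists>a\<in>K \<union> {x}. a \<le> b) \<and> (b \<le> x \<or> (\<exists>k\<in>K. b \<le> sup x k))}"
  have "sup u v \<in> H" if u: "u \<in> H" and v: "v \<in> H" for u v
  proof -
    have "\<exists>a\<in>K \<union> {x}. a \<le> sup u v"
      using u unfolding H_def by (blast intro: le_supI1)
    moreover have "sup u v \<le> x \<or> (\<exists>k\<in>K. sup u v \<le> sup x k)"
    proof (cases "u \<le> x \<and> v \<le> x")
      case False
      then obtain k l where "k \<in> K" "u \<le> sup x k" "l \<in> K" "v \<le> sup x l"
        using u v unfolding H_def by (blast intro: le_supI1)
      moreover from this have "sup u v \<le> sup (sup x k) (sup x l)"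
        by (intro sup_mono)
      ultimately show ?thesis
        using order_algebraic_convex_sup[OF K, of k l] by (metis sup.assoc sup.left_commute sup.left_idem)
    qed simp
    ultimately show ?thesis unfolding H_def by blast
  qed
  moreover have "v \<in> H" if "u \<le> v" "v \<le> w" "u \<in> H" "w \<in> H" for u v w
    using that unfolding H_def by (blast intro: order_trans)
  ultimately have "order_algebraic_convex H"
    unfolding order_algebraic_convex_def by blast
  moreover have "K \<union> {x} \<subseteq> H"
    unfolding H_def using sup_ge2 by blast
  ultimately have "order_algebraic_convex hull (K \<union> {x}) \<subseteq> H"
    by (rule hull_minimal[rotated])
  then show "\<exists>a\<in>K \<union> {x}. a \<le> b" and "b \<le> x \<or> (\<exists>k\<in>K. b \<le> sup x k)"
    using b unfolding H_def by blast+
qed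

section \<open>Trees are the convex geometries\<close>

lemma is_tree_iff_comparable:
  "is_tree TYPE('a::semilattice_sup) \<longleftrightarrow> (\<forall>x y z::'a. x \<le> y \<and> x \<le> z \<longrightarrow> y \<le> z \<or> z \<le> y)"
  unfolding is_tree_def chain_def by auto

lemma tree_comparable:
  "is_tree TYPE('a::semilattice_sup) \<Longrightarrow> (x::'a) \<le> y \<Longrightarrow> x \<le> z \<Longrightarrow> y \<le> z \<or> z \<le> y"
  unfolding is_tree_iff_comparable by blast

text \<open>
  Above an element \<open>a\<close> of \<open>K\<close>, joining \<open>x\<close> with elements of \<open>K\<close> creates nothing beyond
  \<open>x\<close> and \<open>K\<close>, because \<open>\<up>a\<close> is a chain.
\<close>
lemma tree_hull_insert_le:
  fixes K :: "'a::semilattice_sup set"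
  assumes tree: "is_tree TYPE('a)" and K: "order_algebraic_convex K"
    and a: "a \<in> K" "a \<le> x"
    and y: "y \<in> order_algebraic_convex hull (K \<union> {x})" "y \<notin> K"
  shows "y \<le> x"
proof -
  obtain c where c: "c \<in> K" "c \<le> y"
    using hull_insert_bounds(1)[OF K y(1)] a by (auto intro: order_trans)
  consider "y \<le> x" | k where "k \<in> K" "y \<le> sup x k"
    using hull_insert_bounds(2)[OF K y(1)] by blast
  then show ?thesis
  proof cases
    case 2
    define m where "m = sup a k"
    have m: "m \<in> K" "a \<le> m" "y \<le> sup x m"
      using order_algebraic_convex_sup[OF K a(1) \<open>k \<in> K\<close>] \<open>y \<le> sup x k\<close>
      by (auto simp: m_def intro: order_trans[OF _ sup_mono[OF order_refl sup_ge2]])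
    have "\<not> y \<le> m"
      using order_algebraic_convex_between[OF K c(1) m(1) c(2)] y(2) by blast
    then show ?thesis
      using tree_comparable[OF tree a(2) m(2)] m(3) by (auto simp: sup_absorb1 sup_absorb2)
  qed
qed

lemma convex_geometry_if_tree:
  assumes tree: "is_tree TYPE('a::semilattice_sup)"
  shows "convex_geometry (order_algebraic_convex :: 'a set \<Rightarrow> bool)"
  unfolding convex_geometry_def
proof (intro allI impI notI, elim conjE)
  fix K :: "'a set" and x y
  assume K: "order_algebraic_convex K" and neq: "x \<noteq> y" and nin: "x \<notin> K" "y \<notin> K"
    and y: "y \<in> order_algebraic_convex hull (K \<union> {x})"
    and x: "x \<in> order_algebraic_convex hull (K \<union> {y})"
  have lower: "(\<exists>a\<in>K. a \<le> y) \<or> x \<le> y" "(\<exists>a\<in>K. a \<le> x) \<or> y \<le> x"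
    using hull_insert_bounds(1)[OF K y] hull_insert_bounds(1)[OF K x] by auto
  show False
  proof (cases "\<exists>a\<in>K. a \<le> x \<or> a \<le> y")
    case True
    \<comment> \<open>A lower bound in \<open>K\<close> passes from one of the two points to the other.\<close>
    then obtain a b where "a \<in> K" "a \<le> x" "b \<in> K" "b \<le> y"
      using lower by (meson order_trans)
    then have "y \<le> x" "x \<le> y"
      using tree_hull_insert_le[OF tree K] x y nin by blast+
    with neq show False by simp
  next
    case False
    with lower neq show False by (meson order_antisym)
  qed
qed

lemma tree_if_convex_geometry:
  assumes geometry: "convex_geometry (order_algebraic_convex :: 'a::semilattice_sup set \<Rightarrow> bool)"
  shows "is_tree TYPE('a)"
proof (rule ccontr)
  assume "\<not> is_tree TYPE('a)"
  then obtain x y z :: 'a where xyz: "x \<le> y" "x \<le> z" "\<not> y \<le> z" "\<not> z \<le> y"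
    unfolding is_tree_iff_comparable by blast
  let ?hull = "\<lambda>p. order_algebraic_convex hull ({x..z} \<union> {p})"
  have base: "x \<in> ?hull p" "z \<in> ?hull p" "p \<in> ?hull p" for p
    using xyz(2) by (simp_all add: hull_inc)
  have "sup y z \<in> ?hull y"
    by (rule order_algebraic_convex_sup[OF order_algebraic_convex_hull base(3) base(2)])
  moreover have "y \<in> ?hull (sup y z)"
    by (rule order_algebraic_convex_between[OF order_algebraic_convex_hull base(1) base(3) xyz(1) sup_ge1])
  moreover have "y \<noteq> sup y z"
    using xyz(4) sup_ge2[of z y] by metis
  moreover have "y \<notin> {x..z}" "sup y z \<notin> {x..z}"
    using xyz(3) by simp_all
  ultimately show False
    using geometry[unfolded convex_geometry_def, rule_format, of "{x..z}" y "sup y z"]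
      order_algebraic_convex_interval[of x z] by blast
qed

section \<open>Greatest and minimal elements of compact sets\<close>

lemma closedin_atLeast:
  fixes T :: "'a::semilattice_sup topology"
  assumes "Hausdorff_space T" "semitopological_semilattice T"
  shows "closedin T {x..}"
proof -
  have "closedin T {y \<in> topspace T. sup x y = y}"
    using assms
    by (intro closedin_continuous_maps_eq[of T]) (auto simp: semitopological_semilattice_def)
  moreover have "{y \<in> topspace T. sup x y = y} = {x..}"
    using assms(2) unfolding semitopological_semilattice_def atLeast_def le_iff_sup by blast
  ultimately show ?thesis by simp
qed

lemma closedin_atMost:
  fixes T :: "'a::semilattice_sup topology"
  assumes "Hausdorff_space T" "semitopological_semilattice T"
  shows "closedin T {..x}"
proof -
  have "closedin T {y \<in> topspace T. sup x y = x}"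
    using assms
    by (intro closedin_continuous_maps_eq[of T]) (auto simp: semitopological_semilattice_def)
  moreover have "{y \<in> topspace T. sup x y = x} = {..x}"
    using assms(2) unfolding semitopological_semilattice_def atMost_def sup.absorb_iff1 by blast
  ultimately show ?thesis by simp
qed

lemma compactin_closed_family_Int:
  assumes "compactin T K" "\<And>i. i \<in> I \<Longrightarrow> closedin T (f i)"
    and "\<And>J. finite J \<Longrightarrow> J \<subseteq> I \<Longrightarrow> K \<inter> (\<Inter>i\<in>J. f i) \<noteq> {}"
  shows "K \<inter> (\<Inter>i\<in>I. f i) \<noteq> {}"
proof -
  have "K \<inter> \<Inter>\<F> \<noteq> {}" if "finite \<F>" "\<F> \<subseteq> f ` I" for \<F>
    using assms(3) finite_subset_image[OF that] by metis
  then show ?thesis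
    using assms(1,2) unfolding compactin_fip by auto
qed

text \<open>A subsemilattice is directed, so the closed filters of its elements have the finite
  intersection property inside it.\<close>
lemma compact_convex_has_greatest:
  fixes T :: "'a::semilattice_sup topology"
  assumes T: "Hausdorff_space T" "semitopological_semilattice T"
    and K: "order_algebraic_convex K" "compactin T K" "K \<noteq> {}"
  shows "\<exists>t\<in>K. \<forall>x\<in>K. x \<le> t"
proof -
  have "K \<inter> (\<Inter>x\<in>K. {x..}) \<noteq> {}"
  proof (rule compactin_closed_family_Int[OF K(2) closedin_atLeast[OF T]])
    fix J assume "finite J" "J \<subseteq> K"
    then have "\<exists>u\<in>K. \<forall>x\<in>J. x \<le> u"
    proof (induction J rule: finite_induct)
      case empty
      then show ?case using K(3) by blast
    next
      case (insert x J)
      then obtain u where "u \<in> K" "\<forall>y\<in>J. y \<le> u" by auto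
      then show ?case
        using insert.prems order_algebraic_convex_sup[OF K(1), of x u]
        by (auto intro!: bexI[of _ "sup x u"] intro: le_supI2)
    qed
    then show "K \<inter> (\<Inter>x\<in>J. {x..}) \<noteq> {}" by auto
  qed
  then show ?thesis by auto
qed

text \<open>
  By Zorn's lemma, applied to the part of \<open>K\<close> below \<open>x\<close>: the closed ideals of the elements of a
  chain have the finite intersection property, so the chain has a lower bound in \<open>K\<close>.
\<close>
lemma compact_has_minimal_below:
  fixes T :: "'a::semilattice_sup topology"
  assumes T: "Hausdorff_space T" "semitopological_semilattice T"
    and K: "compactin T K" and x: "x \<in> K"
  obtains m where "m \<in> K" "m \<le> x" "\<And>y. y \<in> K \<Longrightarrow> y \<le> m \<Longrightarrow> y = m"
proof -
  have "\<exists>m\<in>{y\<in>K. y \<le> x}. \<forall>y\<in>{y\<in>K. y \<le> x}. y \<le> m \<longrightarrow> y = m"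
  proof (rule predicate_Zorn[where P = "\<lambda>u v. v \<le> u"])
    show "partial_order_on {y\<in>K. y \<le> x} (relation_of (\<lambda>u v. v \<le> u) {y\<in>K. y \<le> x})"
      by (rule partial_order_on_relation_ofI) auto
  next
    fix C assume "C \<in> Chains (relation_of (\<lambda>u v. v \<le> u) {y\<in>K. y \<le> x})"
    then have C: "C \<subseteq> {y\<in>K. y \<le> x}" "\<And>u v. u \<in> C \<Longrightarrow> v \<in> C \<Longrightarrow> u \<le> v \<or> v \<le> u"
      unfolding Chains_def relation_of_def by blast+
    \<comment> \<open>Including \<open>x\<close> keeps the lower bound below \<open>x\<close> even when the chain is empty.\<close>
    have "K \<inter> (\<Inter>u\<in>insert x C. {..u}) \<noteq> {}"
    proof (rule compactin_closed_family_Int[OF K closedin_atMost[OF T]])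
      fix J assume "finite J" "J \<subseteq> insert x C"
      then have "\<exists>l\<in>insert x C. \<forall>u\<in>J. l \<le> u"
      proof (induction J rule: finite_induct)
        case (insert u J)
        then obtain l where "l \<in> insert x C" "\<forall>y\<in>J. l \<le> y" by auto
        moreover have "u \<in> insert x C"
          using insert.prems by simp
        moreover from calculation have "u \<le> l \<or> l \<le> u"
          using C by blast
        ultimately show ?case
          by (auto dest: order_trans)
      qed blast
      then show "K \<inter> (\<Inter>u\<in>J. {..u}) \<noteq> {}"
        using C(1) x by blast
    qed
    then show "\<exists>l\<in>{y\<in>K. y \<le> x}. \<forall>u\<in>C. l \<le> u" by auto
  qed
  then show ?thesis
    using that by (auto intro: order_trans)
qed

section \<open>Extreme points generate compact convex sets\<close>

lemma extreme_point_iff_convex_Diff: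
  fixes K :: "'a::semilattice_sup set"
  assumes K: "order_algebraic_convex K" and x: "x \<in> K"
  shows "x \<in> extreme_points order_algebraic_convex K \<longleftrightarrow> order_algebraic_convex (K - {x})"
proof
  assume "x \<in> extreme_points order_algebraic_convex K"
  then have "order_algebraic_convex hull (K - {x}) \<subseteq> K - {x}"
    using hull_minimal[of "K - {x}" K order_algebraic_convex] K
    by (auto simp: extreme_points_def)
  then have "order_algebraic_convex hull (K - {x}) = K - {x}"
    by (simp add: hull_subset subset_antisym)
  then show "order_algebraic_convex (K - {x})"
    by (metis order_algebraic_convex_hull)
next
  assume "order_algebraic_convex (K - {x})"
  then have "order_algebraic_convex hull (K - {x}) = K - {x}"
    by (rule hull_same)
  then show "x \<in> extreme_points order_algebraic_convex K"
    using x by (simp add: extreme_points_def)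
qed

lemma minimal_is_extreme:
  fixes K :: "'a::semilattice_sup set"
  assumes K: "order_algebraic_convex K" and m: "m \<in> K" "\<And>y. y \<in> K \<Longrightarrow> y \<le> m \<Longrightarrow> y = m"
  shows "m \<in> extreme_points order_algebraic_convex K"
proof -
  have "order_algebraic_convex (K - {m})"
    unfolding order_algebraic_convex_def
  proof (intro conjI ballI allI impI)
    show "sup x y \<in> K - {m}" if "x \<in> K - {m}" "y \<in> K - {m}" for x y
      using that m(2)[of x] order_algebraic_convex_sup[OF K, of x y] by auto
    show "y \<in> K - {m}" if "x \<le> y \<and> y \<le> z \<and> x \<in> K - {m} \<and> z \<in> K - {m}" for x y z
      using that m(2)[of x] order_algebraic_convex_between[OF K, of x z y] by auto
  qed
  then show ?thesis
    by (simp add: extreme_point_iff_convex_Diff[OF K m(1)])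
qed

text \<open>Removing the greatest element cannot destroy order-convexity, so if it is not
  extreme, then closure under joins is what fails.\<close>
lemma greatest_not_extreme_is_sup:
  fixes K :: "'a::semilattice_sup set"
  assumes K: "order_algebraic_convex K" and t: "t \<in> K" "\<And>x. x \<in> K \<Longrightarrow> x \<le> t"
    and not_extreme: "t \<notin> extreme_points order_algebraic_convex K"
  obtains a b where "a \<in> K" "b \<in> K" "a \<noteq> t" "b \<noteq> t" "sup a b = t"
proof -
  have "y \<in> K - {t}" if "x \<le> y \<and> y \<le> z \<and> x \<in> K - {t} \<and> z \<in> K - {t}" for x y z
    using that t(2)[of z] order_algebraic_convex_between[OF K, of x z y]
    by (metis Diff_iff order_antisym singletonD singletonI)
  moreover have "\<not> order_algebraic_convex (K - {t})"
    using not_extreme by (simp add: extreme_point_iff_convex_Diff[OF K t(1)])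
  ultimately obtain a b where "a \<in> K - {t}" "b \<in> K - {t}" "sup a b \<notin> K - {t}"
    unfolding order_algebraic_convex_def by blast
  then show ?thesis
    using that order_algebraic_convex_sup[OF K, of a b] by blast
qed

text \<open>
  The join of \<open>m\<close> and \<open>n\<close> is comparable with \<open>a\<close> in \<open>\<up>m\<close> and with \<open>b\<close> in \<open>\<up>n\<close>. It lies above
  both, since otherwise \<open>a\<close> and \<open>b\<close> would be comparable: through \<open>m \<oplus> n\<close> as an intermediate element,
  or as members of the chain \<open>\<up>(m \<oplus> n)\<close>.
\<close>
lemma tree_sup_of_lower:
  fixes a b :: "'a::semilattice_sup"
  assumes tree: "is_tree TYPE('a)" and "m \<le> a" "n \<le> b" and incomparable: "\<not> a \<le> b" "\<not> b \<le> a"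
  shows "sup m n = sup a b"
proof -
  have "a \<le> sup m n \<or> sup m n \<le> a" "b \<le> sup m n \<or> sup m n \<le> b"
    using tree_comparable[OF tree \<open>m \<le> a\<close>, of "sup m n"]
      tree_comparable[OF tree \<open>n \<le> b\<close>, of "sup m n"] by simp_all
  then have "a \<le> sup m n" "b \<le> sup m n"
    using tree_comparable[OF tree, of "sup m n" a b] incomparable by (meson order_trans)+
  then show ?thesis
    using \<open>m \<le> a\<close> \<open>n \<le> b\<close> by (meson le_supI order_antisym sup_mono)
qed

text \<open>Every point of \<open>K\<close> lies between a minimal element and the greatest element of \<open>K\<close>, so only
  the membership of the greatest element in the hull is at stake.\<close>
lemma tree_compact_convex_eq_hull_extreme_points:
  fixes T :: "'a::semilattice_sup topology"
  assumes tree: "is_tree TYPE('a)"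
    and T: "Hausdorff_space T" "semitopological_semilattice T"
    and K: "order_algebraic_convex K" "compactin T K"
  shows "order_algebraic_convex hull (extreme_points order_algebraic_convex K) = K" (is "?H = K")
proof
  show "?H \<subseteq> K"
    by (rule hull_minimal) (auto simp: extreme_points_def K)
  have below: "\<exists>m\<in>?H. m \<le> x" if "x \<in> K" for x
    using compact_has_minimal_below[OF T K(2) that] minimal_is_extreme[OF K(1)]
    by (metis hull_inc)
  show "K \<subseteq> ?H"
  proof
    fix x assume x: "x \<in> K"
    then obtain t where t: "t \<in> K" "\<And>y. y \<in> K \<Longrightarrow> y \<le> t"
      using compact_convex_has_greatest[OF T K] by blast
    have "t \<in> ?H"
    proof (cases "t \<in> extreme_points order_algebraic_convex K")
      case True
      then show ?thesis by (rule hull_inc)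
    next
      case False
      then obtain a b where ab: "a \<in> K" "b \<in> K" "a \<noteq> t" "b \<noteq> t" "sup a b = t"
        using greatest_not_extreme_is_sup[OF K(1) t] by blast
      obtain m n where mn: "m \<in> ?H" "m \<le> a" "n \<in> ?H" "n \<le> b"
        using below ab(1,2) by blast
      have "\<not> a \<le> b" "\<not> b \<le> a"
        using ab(3-5) by (auto simp: sup.absorb1 sup.absorb2)
      then have "sup m n = t"
        using tree_sup_of_lower[OF tree mn(2,4)] ab(5) by simp
      then show ?thesis
        using order_algebraic_convex_sup[OF order_algebraic_convex_hull mn(1,3)] by simp
    qed
    moreover obtain m where "m \<in> ?H" "m \<le> x"
      using below[OF x] by blast
    ultimately show "x \<in> ?H"
      using order_algebraic_convex_between[OF order_algebraic_convex_hull] t(2)[OF x] by blast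
  qed
qed

theorem proposition7p6:
  shows "(convex_geometry (order_algebraic_convex :: 'a::semilattice_sup set \<Rightarrow> bool)
            \<longleftrightarrow> is_tree TYPE('a)) \<and>
         (is_tree TYPE('a) \<longrightarrow>
            (\<forall>T :: 'a topology. Hausdorff_space T \<and> semitopological_semilattice T
               \<longrightarrow> krein_milman_property order_algebraic_convex T))"
proof (intro conjI impI allI)
  show "convex_geometry (order_algebraic_convex :: 'a set \<Rightarrow> bool) \<longleftrightarrow> is_tree TYPE('a)"
    using convex_geometry_if_tree tree_if_convex_geometry by blast
next
  fix T :: "'a topology"
  assume tree: "is_tree TYPE('a)" and T: "Hausdorff_space T \<and> semitopological_semilattice T"
  show "krein_milman_property order_algebraic_convex T"
    unfolding krein_milman_property_def
  proof (intro allI impI, elim conjE)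
    fix K assume K: "order_algebraic_convex K" "compactin T K"
    then have "closedin T K"
      using T compactin_imp_closedin by blast
    then show "K = T closure_of (order_algebraic_convex hull extreme_points order_algebraic_convex K)"
      using tree_compact_convex_eq_hull_extreme_points[OF tree _ _ K] T
      by (simp add: closure_of_closedin)
  qed
qed

end
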